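(* Let $\mathcal{M}$ be a structure with universe $M$, let $f$ be an $n$-ary functional symbol of its signature, and let $\varphi(x_1,\ldots,x_n,y)$ be the atomic formula $f(x_1,\ldots,x_n)\approx y$. Let $\emptyset\neq P\subseteq M$. Then the tuple $(P_1,\ldots,P_n,Q)=(P,\ldots,P,P)$ is $\varphi$-preserved (i.e. $\varphi$-idempotent) if and only if $P$ is the universe of a subalgebra of the restriction of $\mathcal{M}$ to the signature symbol $f$.
   Context: For a formula $\varphi(x_1,\ldots,x_n,y)$ and $a_1,\ldots,a_n\in M$, $\varphi(a_1,\ldots,a_n,\mathcal{M})=\{b\in M\mid \mathcal{M}\models\varphi(a_1,\ldots,a_n,b)\}$. For $P_1,\ldots,P_n,Q\subseteq M$ the tuple $(P_1,\ldots,P_n,Q)$ is (totally) $\varphi$-preserved if $\varphi(a_1,\ldots,a_n,\mathcal{M})\subseteq Q$ for all $a_1\in P_1,\ldots,a_n\in P_n$. If moreover $P_1=\ldots=P_n=Q$, the $\varphi$-preserved tuple is called $\varphi$-idempotent. *)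

theory Defs
  imports Main
begin

record ('f, 'r) signature =
  funs :: "'f set"
  rels :: "'r set"
  fun_arity :: "'f \<Rightarrow> nat"
  rel_arity :: "'r \<Rightarrow> nat"

record ('f, 'r, 'a) fo_structure =
  sig :: "('f, 'r) signature"
  universe :: "'a set"
  fun_interp :: "'f \<Rightarrow> 'a list \<Rightarrow> 'a"
  rel_interp :: "'r \<Rightarrow> 'a list set"

text \<open>Interpretations are total functions on the HOL types; only their values on symbols of
  the signature and on tuples over the universe of the right length are meaningful.\<close>

definition tuples :: "nat \<Rightarrow> 'a set \<Rightarrow> 'a list set" where
  "tuples n A = {as \<in> lists A. length as = n}"

definition is_structure :: "('f, 'r, 'a) fo_structure \<Rightarrow> bool" where
  "is_structure M \<longleftrightarrow>
     universe M \<noteq> {} \<and>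
     (\<forall>f \<in> funs (sig M). \<forall>as \<in> tuples (fun_arity (sig M) f) (universe M).
        fun_interp M f as \<in> universe M) \<and>
     (\<forall>R \<in> rels (sig M). rel_interp M R \<subseteq> tuples (rel_arity (sig M) R) (universe M))"

definition is_algebra :: "('f, 'r, 'a) fo_structure \<Rightarrow> bool" where
  "is_algebra A \<longleftrightarrow> is_structure A \<and> rels (sig A) = {}"

definition is_subalgebra :: "('f, 'r, 'a) fo_structure \<Rightarrow> ('f, 'r, 'a) fo_structure \<Rightarrow> bool" where
  "is_subalgebra B A \<longleftrightarrow>
     is_algebra A \<and> is_algebra B \<and> sig B = sig A \<and> universe B \<subseteq> universe A \<and>
     (\<forall>f \<in> funs (sig B). \<forall>as \<in> tuples (fun_arity (sig B) f) (universe B).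
        fun_interp B f as = fun_interp A f as)"

text \<open>Restriction of a structure to the signature whose only symbol is the function symbol
  \<open>f\<close>; the interpretations of the other symbols become irrelevant.\<close>

definition fun_reduct :: "('f, 'r, 'a) fo_structure \<Rightarrow> 'f \<Rightarrow> ('f, 'r, 'a) fo_structure" where
  "fun_reduct M f = M\<lparr>sig := (sig M)\<lparr>funs := {f}, rels := {}\<rparr>\<rparr>"

datatype 'f trm = Var nat | App 'f "'f trm list"

datatype ('f, 'r) form =
    Eq "'f trm" "'f trm"
  | Rel 'r "'f trm list"
  | Neg "('f, 'r) form"
  | Conj "('f, 'r) form" "('f, 'r) form"
  | Disj "('f, 'r) form" "('f, 'r) form"
  | Impl "('f, 'r) form" "('f, 'r) form"
  | Exi nat "('f, 'r) form"
  | Uni nat "('f, 'r) form"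

primrec eval :: "('f, 'r, 'a) fo_structure \<Rightarrow> (nat \<Rightarrow> 'a) \<Rightarrow> 'f trm \<Rightarrow> 'a" where
  "eval M e (Var v) = e v"
| "eval M e (App f ts) = fun_interp M f (map (eval M e) ts)"

primrec sat :: "('f, 'r, 'a) fo_structure \<Rightarrow> (nat \<Rightarrow> 'a) \<Rightarrow> ('f, 'r) form \<Rightarrow> bool" where
  "sat M e (Eq s t) \<longleftrightarrow> eval M e s = eval M e t"
| "sat M e (Rel R ts) \<longleftrightarrow> map (eval M e) ts \<in> rel_interp M R"
| "sat M e (Neg \<phi>) \<longleftrightarrow> \<not> sat M e \<phi>"
| "sat M e (Conj \<phi> \<psi>) \<longleftrightarrow> sat M e \<phi> \<and> sat M e \<psi>"
| "sat M e (Disj \<phi> \<psi>) \<longleftrightarrow> sat M e \<phi> \<or> sat M e \<psi>"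
| "sat M e (Impl \<phi> \<psi>) \<longleftrightarrow> (sat M e \<phi> \<longrightarrow> sat M e \<psi>)"
| "sat M e (Exi v \<phi>) \<longleftrightarrow> (\<exists>b \<in> universe M. sat M (e(v := b)) \<phi>)"
| "sat M e (Uni v \<phi>) \<longleftrightarrow> (\<forall>b \<in> universe M. sat M (e(v := b)) \<phi>)"

text \<open>A formula \<open>\<phi>(x\<^sub>1, \<dots>, x\<^sub>n, y)\<close> is represented by \<open>\<phi>\<close> together with the list \<open>xs\<close> of the
  variables \<open>x\<^sub>1, \<dots>, x\<^sub>n\<close> and the variable \<open>y\<close>. The notions below are meant for distinct
  \<open>xs @ [y]\<close> containing all free variables of \<open>\<phi>\<close>; satisfaction then does not depend on the
  choice of the assignment \<open>e\<close>.\<close>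

definition holds_at ::
    "('f, 'r, 'a) fo_structure \<Rightarrow> ('f, 'r) form \<Rightarrow> nat list \<Rightarrow> nat \<Rightarrow> 'a list \<Rightarrow> 'a \<Rightarrow> bool" where
  "holds_at M \<phi> xs y as b \<longleftrightarrow>
     (\<forall>e. range e \<subseteq> universe M \<and> map e xs = as \<and> e y = b \<longrightarrow> sat M e \<phi>)"

definition solution_set ::
    "('f, 'r, 'a) fo_structure \<Rightarrow> ('f, 'r) form \<Rightarrow> nat list \<Rightarrow> nat \<Rightarrow> 'a list \<Rightarrow> 'a set" where
  "solution_set M \<phi> xs y as = {b \<in> universe M. holds_at M \<phi> xs y as b}"

definition preserved ::
    "('f, 'r, 'a) fo_structure \<Rightarrow> ('f, 'r) form \<Rightarrow> nat list \<Rightarrow> nat \<Rightarrow> 'a set list \<Rightarrow> 'a set \<Rightarrow> bool"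
  where
  "preserved M \<phi> xs y Ps Q \<longleftrightarrow>
     length Ps = length xs \<and> (\<forall>P \<in> set Ps. P \<subseteq> universe M) \<and> Q \<subseteq> universe M \<and>
     (\<forall>as \<in> listset Ps. solution_set M \<phi> xs y as \<subseteq> Q)"

definition idempotent ::
    "('f, 'r, 'a) fo_structure \<Rightarrow> ('f, 'r) form \<Rightarrow> nat list \<Rightarrow> nat \<Rightarrow> 'a set list \<Rightarrow> 'a set \<Rightarrow> bool"
  where
  "idempotent M \<phi> xs y Ps Q \<longleftrightarrow> preserved M \<phi> xs y Ps Q \<and> (\<forall>P \<in> set Ps. P = Q)"

end

theory Submission imports Defs begin

text \<open>Since f is interpreted by a total operation, the equation f(as) = y has exactly one
  solution y in M, namely the value of f at \<open>as\<close> (\<open>solution_set_Eq_App\<close>).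
  Preservation of (P,...,P,P) therefore says precisely that P is closed under f
  (\<open>preserved_Eq_App_iff_closed\<close>). Nonempty subsets closed under f are exactly the
  universes of subalgebras of the reduct to f
  (\<open>ex_subalgebra_fun_reduct_iff_closed\<close>).\<close>

lemma listset_replicate: "listset (replicate n A) = tuples n A"
proof (induction n)
  case 0
  then show ?case by (auto simp: tuples_def)
next
  case (Suc n)
  then show ?case
    by (auto simp: tuples_def set_Cons_def length_Suc_conv)
qed

lemma tuples_mono: "A \<subseteq> B \<Longrightarrow> tuples n A \<subseteq> tuples n B"
  by (auto simp: tuples_def)

text \<open>Keeps \<open>holds_at\<close> from being vacuously true: that predicate ranges over all
  assignments with the prescribed values, so at least one must exist. Distinctness makes the
  prescriptions compatible.\<close>

lemma ex_assignment:
  assumes "distinct (xs @ [y])" and "length as = length xs" and "set as \<subseteq> A" and "b \<in> A"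
  shows "\<exists>e. range e \<subseteq> A \<and> map e xs = as \<and> e y = b"
proof -
  define m where "m = map_of (zip xs as)"
  \<comment> \<open>The default \<open>b\<close> does double duty: it gives \<open>y\<close>, which
    is not in \<open>xs\<close>, its value, and it keeps all remaining variables inside
    \<open>A\<close>.\<close>
  define e where "e v = (case m v of None \<Rightarrow> b | Some a \<Rightarrow> a)" for v
  have "ran m \<subseteq> A"
    using assms by (auto simp: m_def ran_map_of_zip)
  then have "e v \<in> A" for v
    using assms(4) ranI[of m v] by (cases "m v") (auto simp: e_def)
  then have "range e \<subseteq> A"
    by blast
  moreover have "map e xs = as"
    using assms by (auto intro!: nth_equalityI simp: e_def m_def map_of_zip_nth)
  moreover have "m y = None"
    using assms by (auto simp: m_def map_of_zip_is_None)
  then have "e y = b"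
    by (simp add: e_def)
  ultimately show ?thesis
    by blast
qed

text \<open>All assignments agreeing on \<open>xs\<close> and \<open>y\<close> give the equation the
  same truth value, so a single one decides it; the value of f lies in the universe because M is a
  structure.\<close>

lemma solution_set_Eq_App:
  assumes "is_structure M" and "f \<in> funs (sig M)"
    and "distinct (xs @ [y])" and "length xs = fun_arity (sig M) f"
    and as: "as \<in> tuples (length xs) (universe M)"
  shows "solution_set M (Eq (App f (map Var xs)) (Var y)) xs y as = {fun_interp M f as}"
proof -
  have "holds_at M (Eq (App f (map Var xs)) (Var y)) xs y as b \<longleftrightarrow> fun_interp M f as = b"
    if b: "b \<in> universe M" for b
  proof -
    have "length as = length xs" and "set as \<subseteq> universe M"
      using as by (auto simp: tuples_def)
    then obtain e where "range e \<subseteq> universe M" "map e xs = as" "e y = b"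
      using ex_assignment[OF assms(3) _ _ b] by blast
    then show ?thesis
      by (auto simp: holds_at_def comp_def)
  qed
  moreover have "fun_interp M f as \<in> universe M"
    using assms by (simp add: is_structure_def)
  ultimately show ?thesis
    by (auto simp: solution_set_def)
qed

lemma preserved_Eq_App_iff_closed:
  assumes "is_structure M" and "f \<in> funs (sig M)"
    and "distinct (xs @ [y])" and "length xs = fun_arity (sig M) f" and "P \<subseteq> universe M"
  shows "preserved M (Eq (App f (map Var xs)) (Var y)) xs y (replicate (length xs) P) P \<longleftrightarrow>
    (\<forall>as \<in> tuples (length xs) P. fun_interp M f as \<in> P)"
  using solution_set_Eq_App[OF assms(1-4)] tuples_mono[OF assms(5)] assms(5)
  by (auto simp: preserved_def listset_replicate subset_iff)

lemma is_algebra_fun_reduct: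
  "is_structure M \<Longrightarrow> f \<in> funs (sig M) \<Longrightarrow> is_algebra (fun_reduct M f)"
  by (simp add: is_algebra_def is_structure_def fun_reduct_def)

lemma ex_subalgebra_fun_reduct_iff_closed:
  assumes "is_structure M" and "f \<in> funs (sig M)" and "P \<noteq> {}" and "P \<subseteq> universe M"
  shows "(\<exists>B. is_subalgebra B (fun_reduct M f) \<and> universe B = P) \<longleftrightarrow>
    (\<forall>as \<in> tuples (fun_arity (sig M) f) P. fun_interp M f as \<in> P)" (is "?sub \<longleftrightarrow> ?closed")
proof
  assume ?sub
  then show ?closed
    by (auto simp: is_subalgebra_def is_algebra_def is_structure_def fun_reduct_def)
next
  assume ?closed
  \<comment> \<open>The witness keeps the operations and only shrinks the universe. Closure makes it
    a structure, as P is nonempty and the reduct has no relation symbols to constrain.\<close>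
  then have "is_subalgebra ((fun_reduct M f)\<lparr>universe := P\<rparr>) (fun_reduct M f)"
    using assms is_algebra_fun_reduct[OF assms(1,2)]
    by (simp add: is_subalgebra_def is_algebra_def is_structure_def fun_reduct_def)
  then show ?sub
    by (intro exI[of _ "(fun_reduct M f)\<lparr>universe := P\<rparr>"]) simp
qed

theorem proposition4p2:
  fixes M :: "('f, 'r, 'a) fo_structure" and f :: 'f and n :: nat
    and xs :: "nat list" and y :: nat and \<phi> :: "('f, 'r) form" and P :: "'a set"
  assumes "is_structure M"
    and "f \<in> funs (sig M)" and "fun_arity (sig M) f = n"
    and "length xs = n" and "distinct (xs @ [y])"
    and "\<phi> = Eq (App f (map Var xs)) (Var y)"
    and "P \<noteq> {}" and "P \<subseteq> universe M"
  shows "(preserved M \<phi> xs y (replicate n P) P \<longleftrightarrow>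
            (\<exists>B. is_subalgebra B (fun_reduct M f) \<and> universe B = P)) \<and>
         (idempotent M \<phi> xs y (replicate n P) P \<longleftrightarrow>
            (\<exists>B. is_subalgebra B (fun_reduct M f) \<and> universe B = P))"
proof -
  \<comment> \<open>The extra clause of idempotence holds automatically, as every entry of
    \<open>replicate n P\<close> is P.\<close>
  have "idempotent M \<phi> xs y (replicate n P) P \<longleftrightarrow> preserved M \<phi> xs y (replicate n P) P"
    by (auto simp: idempotent_def)
  moreover have "preserved M \<phi> xs y (replicate n P) P \<longleftrightarrow>
      (\<exists>B. is_subalgebra B (fun_reduct M f) \<and> universe B = P)"
    using preserved_Eq_App_iff_closed[of M f xs y P]
      ex_subalgebra_fun_reduct_iff_closed[of M f P] assms
    by simp
  ultimately show ?thesis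
    by blast
qed

end
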